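(* Let $\mathbb{H}^3=\{(\tilde x^1,\tilde x^2,\tilde x^3)\in\mathbb{R}^3:\tilde x^3>0\}$ and let $(\mathbb{H}^3,\tilde F=\tilde\alpha^2/\tilde\beta)$ be the Kropina space where $\tilde\alpha=\frac{\sqrt{(d\tilde x^1)^2+(d\tilde x^2)^2+(d\tilde x^3)^2}}{\tilde x^3}$ is the hyperbolic metric and $\tilde\beta=\frac{b\,d\tilde x^1}{(\tilde x^3)^2}$ is a $1$-form, with $b\neq 0$ a constant. Let $\varphi:M^2\subset\mathbb{R}^2\to\mathbb{H}^3$ be an immersion given by $$\varphi(x^1,x^2)=(f(x^1)\cos x^2,\ f(x^1)\sin x^2,\ x^1),$$ where $f$ is a smooth positive real valued function defined on $\mathbb{R}_{>0}$. Then $\varphi$ can never be minimal.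
   Context: Indices: $\epsilon,\eta$ range over $\{1,2\}$; $i,j$ range over $\{1,2,3\}$; repeated indices are summed. A Kropina metric $\tilde\alpha^2/\tilde\beta$ ($\tilde\alpha$ Riemannian, $\tilde\beta$ a $1$-form) is a conic Finsler metric, defined on directions with $\tilde\beta>0$. An immersion $\varphi:M^2\to(\mathbb{H}^3,\tilde F)$ induces $F(x,y)=\tilde F(\varphi(x),\varphi_*(y))$ on $M$. Put $z=(z^i_\epsilon)=\left(\frac{\partial\varphi^i}{\partial x^\epsilon}\right)$, $D^2_x(1)=\{(y^1,y^2)\in T_xM: F(x,y)<1\}$ (within the domain of the conic metric), and $$\mathcal F(x,z)=\frac{\mathrm{vol}(B^2(1))}{\mathrm{vol}(D^2_x(1))},$$ where $B^2(1)$ is the Euclidean unit ball and $\mathrm{vol}$ is Euclidean volume; $\mathcal F$ is regarded as a function of $\tilde x=\varphi(x)$ and of the matrix $z$. The mean curvature of $\varphi$ along a vector field $v=(v^i)$ on $\mathbb{H}^3$ is $$\mathcal H_\varphi(v)=\frac1{\mathcal F}\left\{\frac{\partial^2\mathcal F}{\partial z^i_\epsilon\partial z^j_\eta}\frac{\partial^2\varphi^j}{\partial x^\epsilon\partial x^\eta}+\frac{\partial^2\mathcal F}{\partial z^i_\epsilon\partial\tilde x^j}\frac{\partial\varphi^j}{\partial x^\epsilon}-\frac{\partial\mathcal F}{\partial\tilde x^i}\right\}v^i .$$ Since here $\tilde F$ does not depend on the base point, this reduces to $\mathcal H_\varphi(v)=\frac1{\mathcal F}\frac{\partial^2\mathcal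 F}{\partial z^i_\epsilon\partial z^j_\eta}\frac{\partial^2\varphi^j}{\partial x^\epsilon\partial x^\eta}v^i$. The immersion $\varphi$ is minimal if $\mathcal H_\varphi=0$ identically (for all $v$). *)

theory Defs
  imports "HOL-Analysis.Analysis"
begin

text \<open>
  \<open>C\<^sup>k\<close> and smooth maps on an open set \<open>S\<close>; the directional derivatives along the
  standard basis are the partial derivatives.
\<close>

primrec Ck_on :: "nat \<Rightarrow> 'a::euclidean_space set \<Rightarrow> ('a \<Rightarrow> 'b::real_normed_vector) \<Rightarrow> bool" where
  "Ck_on 0 S g \<longleftrightarrow> continuous_on S g"
| "Ck_on (Suc k) S g \<longleftrightarrow> (\<forall>x\<in>S. g differentiable (at x)) \<and>
     (\<forall>e\<in>Basis. Ck_on k S (\<lambda>x. frechet_derivative g (at x) e))"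

definition smooth_on :: "'a::euclidean_space set \<Rightarrow> ('a \<Rightarrow> 'b::real_normed_vector) \<Rightarrow> bool" where
  "smooth_on S g \<longleftrightarrow> (\<forall>k. Ck_on k S g)"

definition immersion :: "(real^2) set \<Rightarrow> (real^3) set \<Rightarrow> (real^2 \<Rightarrow> real^3) \<Rightarrow> bool" where
  "immersion M N \<phi> \<longleftrightarrow> smooth_on M \<phi> \<and> \<phi> ` M \<subseteq> N \<and>
     (\<forall>x\<in>M. inj (frechet_derivative \<phi> (at x)))"

definition partial :: "'a::real_vector \<Rightarrow> ('a \<Rightarrow> real) \<Rightarrow> 'a \<Rightarrow> real" where
  "partial e g p = deriv (\<lambda>t. g (p + t *\<^sub>R e)) 0"

text \<open>
  A conic Finsler metric on (a part of) \<open>\<real>\<^sup>3\<close> is given by the cone \<open>C x\<close> of admissible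
  directions at each point \<open>x\<close> and by \<open>F x v\<close> for \<open>v \<in> C x\<close>; values of \<open>F\<close> off the
  cone are never used.

  A matrix \<open>z :: real^2^3\<close> has entries \<open>z $ i $ \<epsilon>\<close>, so \<open>z *v y\<close> is the push-forward of
  \<open>y\<close> when \<open>z\<close> is the Jacobian of a map from the plane.  Hence \<open>unit_disc C F (\<phi> x, d\<phi>\<^sub>x)\<close>
  is the open unit disc of the metric induced on the surface by \<open>\<phi>\<close>.
\<close>

type_synonym cone_field = "real^3 \<Rightarrow> (real^3) set"
type_synonym metric_fun = "real^3 \<Rightarrow> real^3 \<Rightarrow> real"

definition unit_disc :: "cone_field \<Rightarrow> metric_fun \<Rightarrow> (real^3) \<times> (real^2^3) \<Rightarrow> (real^2) set" where
  "unit_disc C F = (\<lambda>(p, z). {y. z *v y \<in> C p \<and> F p (z *v y) < 1})"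

definition vol_ratio :: "cone_field \<Rightarrow> metric_fun \<Rightarrow> (real^3) \<times> (real^2^3) \<Rightarrow> real" where
  "vol_ratio C F q =
     measure lebesgue (ball 0 1 :: (real^2) set) / measure lebesgue (unit_disc C F q)"

definition jacobian :: "(real^2 \<Rightarrow> real^3) \<Rightarrow> real^2 \<Rightarrow> real^2^3" where
  "jacobian \<phi> x = (\<chi> i \<epsilon>. partial (axis \<epsilon> 1) (\<lambda>u. \<phi> u $ i) x)"

text \<open>Coordinate directions \<open>\<partial>/\<partial>x\<^sup>i\<close> and \<open>\<partial>/\<partial>z\<^sup>i\<^sub>\<epsilon>\<close> in the space of pairs \<open>(x, z)\<close>.\<close>

definition dir_x :: "3 \<Rightarrow> (real^3) \<times> (real^2^3)" where
  "dir_x i = (axis i 1, 0)"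

definition dir_z :: "3 \<Rightarrow> 2 \<Rightarrow> (real^3) \<times> (real^2^3)" where
  "dir_z i \<epsilon> = (0, axis i (axis \<epsilon> 1))"

text \<open>
  The mean curvature is meaningful only where the tangent plane of the surface meets the
  cone.  Elsewhere the unit disc is empty, so \<open>vol_ratio\<close> is \<open>_ / 0 = 0\<close> and the prefactor
  below is \<open>1 / 0 = 0\<close>: minimality imposes no condition at such points.
\<close>

definition mean_curvature ::
  "cone_field \<Rightarrow> metric_fun \<Rightarrow> (real^2 \<Rightarrow> real^3) \<Rightarrow> (real^3 \<Rightarrow> real^3) \<Rightarrow> real^2 \<Rightarrow> real" where
  "mean_curvature C F \<phi> v x =
     (let G = vol_ratio C F; q = (\<phi> x, jacobian \<phi> x) in
      1 / G q *
      (\<Sum>i\<in>UNIV.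
         ((\<Sum>j\<in>UNIV. \<Sum>\<epsilon>\<in>UNIV. \<Sum>\<eta>\<in>UNIV.
             partial (dir_z i \<epsilon>) (partial (dir_z j \<eta>) G) q *
             partial (axis \<epsilon> 1) (partial (axis \<eta> 1) (\<lambda>u. \<phi> u $ j)) x)
          + (\<Sum>j\<in>UNIV. \<Sum>\<epsilon>\<in>UNIV.
             partial (dir_z i \<epsilon>) (partial (dir_x j) G) q *
             partial (axis \<epsilon> 1) (\<lambda>u. \<phi> u $ j) x)
          - partial (dir_x i) G q)
         * v (\<phi> x) $ i))"

definition minimal ::
  "(real^3) set \<Rightarrow> cone_field \<Rightarrow> metric_fun \<Rightarrow> (real^2) set \<Rightarrow> (real^2 \<Rightarrow> real^3) \<Rightarrow> bool" where
  "minimal N C F M \<phi> \<longleftrightarrow>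
     (\<forall>v. smooth_on N v \<longrightarrow> (\<forall>x\<in>M. mean_curvature C F \<phi> v x = 0))"

definition kropina_cone :: "metric_fun \<Rightarrow> cone_field" where
  "kropina_cone \<beta> p = {v. \<beta> p v > 0}"

definition kropina :: "metric_fun \<Rightarrow> metric_fun \<Rightarrow> metric_fun" where
  "kropina \<alpha> \<beta> p v = (\<alpha> p v)\<^sup>2 / \<beta> p v"

definition half_space :: "(real^3) set" where
  "half_space = {p. p $ 3 > 0}"

definition hyp_alpha :: metric_fun where
  "hyp_alpha p v = sqrt ((v $ 1)\<^sup>2 + (v $ 2)\<^sup>2 + (v $ 3)\<^sup>2) / p $ 3"

definition hyp_beta :: "real \<Rightarrow> metric_fun" where
  "hyp_beta b p v = b * v $ 1 / (p $ 3)\<^sup>2"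

end

theory Submission
  imports Defs
begin

text \<open>
  In \<open>\<alpha>\<^sup>2 / \<beta>\<close> the height cancels, so the metric is \<open>F v = (norm v)\<^sup>2 / (b * v $ 1)\<close> at every point
  of the half-space.  In a tangent plane with basis the columns of \<open>z\<close>, its unit disc is the region
  \<open>(norm (z *v y))\<^sup>2 < b * (z *v y) $ 1\<close>, the interior of an ellipse through the origin.  Computing
  its area (\<open>measure_ellipse\<close>) shows that the volume ratio depends on \<open>z\<close> only through the normal
  \<open>n = z\<^sub>1 \<times> z\<^sub>2\<close> (\<open>vol_ratio_kropina\<close>):
  it equals \<open>4 / b\<^sup>2\<close> times \<open>\<Phi> n = (norm n) ^ 3 / (n\<^sub>2\<^sup>2 + n\<^sub>3\<^sup>2)\<close>.

  Minimality is thus the Euler-Lagrange equation of the anisotropic area with density \<open>\<Phi>\<close>.  Since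
  the normal is bilinear in the columns of \<open>z\<close>, the second derivatives of \<open>\<Phi> \<circ> normal\<close>, contracted
  with those of the immersion, reduce to the Hessian of \<open>\<Phi>\<close> applied to the derivatives of the
  normal field (\<open>mean_curvature_kropina\<close>).

  For the surface generated by \<open>f\<close>, put \<open>m = f'\<^sup>2\<close>, \<open>k = f f''\<close> and \<open>S = sin\<^sup>2 x\<^sup>2\<close>.  Testing the mean
  curvature with the constant field along the first axis gives, where the sine and cosine of \<open>x\<^sup>2\<close> do not
  vanish, a polynomial equation of degree two in \<open>S\<close> with coefficients depending on \<open>m\<close> and \<open>k\<close> only
  (\<open>revolution_minimal_equation\<close>).  The first parameter \<open>x\<^sup>1\<close> can be held fixed while \<open>x\<^sup>2\<close> runs through an
  interval; then \<open>S\<close> takes infinitely many values, and all three coefficients must vanish.  They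
  have no common zero with \<open>m \<ge> 0\<close> (\<open>revolution_quadratic_contradiction\<close>), so the profile is excluded
  already at a single height.  That \<open>S\<close> varies along a parallel reflects the two different axes: the
  density is symmetric about the first one, the surface about the third.
\<close>

section \<open>Partial derivatives\<close>

lemma partial_cong_open:
  assumes "open S" "p \<in> S" "\<And>q. q \<in> S \<Longrightarrow> g q = h q"
  shows "partial e g p = partial e h (p :: 'a::real_normed_vector)"
proof -
  have "((\<lambda>t. p + t *\<^sub>R e) \<longlongrightarrow> p + 0 *\<^sub>R e) (nhds 0)"
    by (intro tendsto_intros filterlim_ident)
  then have "eventually (\<lambda>t. p + t *\<^sub>R e \<in> S) (nhds 0)"
    using assms(1,2) by (auto dest: topological_tendstoD)
  then have "eventually (\<lambda>t. g (p + t *\<^sub>R e) = h (p + t *\<^sub>R e)) (nhds 0)"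
    by eventually_elim (use assms(3) in auto)
  then show ?thesis
    unfolding partial_def by (intro deriv_cong_ev) auto
qed

lemma partial_eqI:
  assumes "((\<lambda>t. g (p + t *\<^sub>R e)) has_real_derivative D) (at 0)"
  shows "partial e g p = D"
  using assms unfolding partial_def by (rule DERIV_imp_deriv)

section \<open>The anisotropic area density and its first two derivatives\<close>

text \<open>
  The inner product of the parts of \<open>u\<close> and \<open>w\<close> orthogonal to the first axis, the direction
  singled out by the one-form.
\<close>

definition transverse :: "real^3 \<Rightarrow> real^3 \<Rightarrow> real" where
  "transverse u w = u $ 2 * w $ 2 + u $ 3 * w $ 3"

definition area_density :: "real^3 \<Rightarrow> real" where
  "area_density n = norm n ^ 3 / transverse n n"

definition area_density' :: "real^3 \<Rightarrow> real^3 \<Rightarrow> real" where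
  "area_density' n u = 3 * norm n * (n \<bullet> u) / transverse n n
     - 2 * norm n ^ 3 * transverse n u / (transverse n n)\<^sup>2"

text \<open>
  The Hessian of \<open>area_density\<close> at \<open>n\<close>, kept as a bilinear form: all the chain rules below
  then need only the inner products of the vectors involved, never their coordinates.
\<close>

definition area_density'' :: "real^3 \<Rightarrow> real^3 \<Rightarrow> real^3 \<Rightarrow> real" where
  "area_density'' n u w =
     (3 * norm n * (u \<bullet> w) + 3 * (n \<bullet> u) * (n \<bullet> w) / norm n) / transverse n n
     - 6 * norm n * ((n \<bullet> u) * transverse n w + (n \<bullet> w) * transverse n u) / (transverse n n)\<^sup>2
     + norm n ^ 3 * (8 * transverse n u * transverse n w / transverse n n ^ 3
                     - 2 * transverse u w / (transverse n n)\<^sup>2)"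

lemma transverse_nonzeroD: "transverse n n \<noteq> 0 \<Longrightarrow> n \<noteq> 0"
  by (auto simp: transverse_def)

lemma transverse_commute: "transverse u w = transverse w u"
  by (simp add: transverse_def mult.commute)

lemma bounded_bilinear_transverse: "bounded_bilinear transverse"
  unfolding transverse_def
  by (intro bilinear_conv_bounded_bilinear[THEN iffD1])
     (auto simp: bilinear_def intro!: linearI simp: algebra_simps)

lemma has_real_derivative_transverse:
  assumes "(u has_vector_derivative u') (at t)" "(w has_vector_derivative w') (at t)"
  shows "((\<lambda>t. transverse (u t) (w t)) has_real_derivative transverse (u t) w' + transverse u' (w t)) (at t)"
  using bounded_bilinear.has_vector_derivative[OF bounded_bilinear_transverse assms]
  by (simp add: has_real_derivative_iff_has_vector_derivative)

lemma has_real_derivative_inner: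
  fixes u w :: "real \<Rightarrow> 'a::real_inner"
  assumes "(u has_vector_derivative u') (at t)" "(w has_vector_derivative w') (at t)"
  shows "((\<lambda>t. u t \<bullet> w t) has_real_derivative u t \<bullet> w' + u' \<bullet> w t) (at t)"
  using bounded_bilinear.has_vector_derivative[OF bounded_bilinear_inner assms]
  by (simp add: has_real_derivative_iff_has_vector_derivative)

lemma has_real_derivative_norm:
  fixes n :: "real \<Rightarrow> 'a::real_inner"
  assumes "(n has_vector_derivative n') (at t)" "n t \<noteq> 0"
  shows "((\<lambda>t. norm (n t)) has_real_derivative n t \<bullet> n' / norm (n t)) (at t)"
proof -
  have "((\<lambda>t. n t \<bullet> n t) has_real_derivative n t \<bullet> n' + n' \<bullet> n t) (at t)"
    by (rule has_real_derivative_inner[OF assms(1,1)])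
  moreover have "0 < n t \<bullet> n t"
    using assms(2) by simp
  ultimately have "((\<lambda>t. sqrt (n t \<bullet> n t)) has_real_derivative
      inverse (sqrt (n t \<bullet> n t)) / 2 * (n t \<bullet> n' + n' \<bullet> n t)) (at t)"
    by (intro DERIV_chain2[where f = sqrt] DERIV_real_sqrt)
  then show ?thesis
    by (simp add: norm_eq_sqrt_inner inner_commute divide_simps)
qed

text \<open>
  Along a curve \<open>n\<close> the norm and the transverse square are real functions with derivatives
  \<open>(n \<bullet> n') / norm n\<close> and \<open>2 * transverse n n'\<close>; the rest is the quotient rule.
\<close>

lemma area_density_has_derivative:
  assumes n: "(n has_vector_derivative n') (at t)" and nz: "transverse (n t) (n t) \<noteq> 0"
  shows "((\<lambda>t. area_density (n t)) has_real_derivative area_density' (n t) n') (at t)"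
proof -
  have n0: "norm (n t) \<noteq> 0" "n t \<noteq> 0" using transverse_nonzeroD[OF nz] by simp_all
  define r s where "r = (\<lambda>t. norm (n t))" and "s = (\<lambda>t. transverse (n t) (n t))"
  define p q where "p = n t \<bullet> n'" and "q = transverse (n t) n'"
  have [simp]: "r t \<noteq> 0" "s t \<noteq> 0" using n0 nz by (auto simp: r_def s_def)
  have r: "(r has_real_derivative p / r t) (at t)"
    unfolding r_def p_def by (rule has_real_derivative_norm[OF n n0(2)])
  have s: "(s has_real_derivative 2 * q) (at t)"
    using has_real_derivative_transverse[OF n n]
    by (simp add: s_def q_def transverse_commute)
  have "((\<lambda>t. r t ^ 3 / s t) has_real_derivative
          (3 * (p / r t * (r t)\<^sup>2) * s t - r t ^ 3 * (2 * q)) / (s t * s t)) (at t)"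
    by (auto intro!: derivative_eq_intros r s)
  also have "(3 * (p / r t * (r t)\<^sup>2) * s t - r t ^ 3 * (2 * q)) / (s t * s t)
      = 3 * r t * p / s t - 2 * r t ^ 3 * q / (s t)\<^sup>2"
    by (simp add: field_simps power2_eq_square)
  finally show ?thesis
    by (simp add: area_density_def area_density'_def r_def s_def p_def q_def)
qed

text \<open>
  The base point and the direction move at the same time, because the derivative of the normal
  of \<open>z\<close> in a fixed matrix direction itself depends on \<open>z\<close>.  The last summand is the contribution
  of the moving direction.
\<close>

lemma area_density'_has_derivative:
  assumes n: "(n has_vector_derivative n') (at t)" and m: "(m has_vector_derivative m') (at t)"
    and nz: "transverse (n t) (n t) \<noteq> 0"
  shows "((\<lambda>t. area_density' (n t) (m t)) has_real_derivative
           area_density'' (n t) n' (m t) + area_density' (n t) m') (at t)"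
proof -
  have n0: "norm (n t) \<noteq> 0" "n t \<noteq> 0" using transverse_nonzeroD[OF nz] by simp_all
  define r s where "r = (\<lambda>t. norm (n t))" and "s = (\<lambda>t. transverse (n t) (n t))"
  define p q where "p = (\<lambda>t. n t \<bullet> m t)" and "q = (\<lambda>t. transverse (n t) (m t))"
  define a b c d e h where "a = n t \<bullet> n'" and "b = transverse (n t) n'"
    and "c = n' \<bullet> m t" and "d = transverse n' (m t)"
    and "e = n t \<bullet> m'" and "h = transverse (n t) m'"
  have [simp]: "r t \<noteq> 0" "s t \<noteq> 0" using n0 nz by (auto simp: r_def s_def)
  have r: "(r has_real_derivative a / r t) (at t)"
    unfolding r_def a_def by (rule has_real_derivative_norm[OF n n0(2)])
  have s: "(s has_real_derivative 2 * b) (at t)"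
    using has_real_derivative_transverse[OF n n]
    by (simp add: s_def b_def transverse_commute)
  have p: "(p has_real_derivative e + c) (at t)"
    unfolding p_def e_def c_def by (rule has_real_derivative_inner[OF n m])
  have q: "(q has_real_derivative h + d) (at t)"
    unfolding q_def h_def d_def by (rule has_real_derivative_transverse[OF n m])
  have "((\<lambda>t. 3 * r t * p t / s t - 2 * r t ^ 3 * q t / (s t)\<^sup>2) has_real_derivative
          ((3 * (a / r t) * p t + 3 * r t * (e + c)) * s t - 3 * r t * p t * (2 * b)) / (s t * s t)
          - ((2 * (3 * (a / r t * (r t)\<^sup>2)) * q t + 2 * r t ^ 3 * (h + d)) * (s t)\<^sup>2
             - 2 * r t ^ 3 * q t * (2 * (2 * b * s t))) / ((s t)\<^sup>2 * (s t)\<^sup>2)) (at t)"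
    by (auto intro!: derivative_eq_intros r s p q simp: algebra_simps)
  also have "((3 * (a / r t) * p t + 3 * r t * (e + c)) * s t - 3 * r t * p t * (2 * b)) / (s t * s t)
          - ((2 * (3 * (a / r t * (r t)\<^sup>2)) * q t + 2 * r t ^ 3 * (h + d)) * (s t)\<^sup>2
             - 2 * r t ^ 3 * q t * (2 * (2 * b * s t))) / ((s t)\<^sup>2 * (s t)\<^sup>2)
      = (3 * r t * c + 3 * a * p t / r t) / s t - 6 * r t * (a * q t + p t * b) / (s t)\<^sup>2
        + r t ^ 3 * (8 * b * q t / s t ^ 3 - 2 * d / (s t)\<^sup>2)
        + (3 * r t * e / s t - 2 * r t ^ 3 * h / (s t)\<^sup>2)"
    by (simp add: power2_eq_square power3_eq_cube divide_simps) (simp add: algebra_simps)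
  finally show ?thesis
    by (simp add: area_density'_def area_density''_def r_def s_def p_def q_def a_def b_def c_def d_def e_def h_def)
qed

lemma linear_area_density': "linear (area_density' n)"
  by (rule linearI)
     (simp_all add: area_density'_def transverse_def inner_add_right algebra_simps add_divide_distrib diff_divide_distrib)

lemma linear_area_density'': "linear (\<lambda>w. area_density'' n u w)"
proof (rule linearI)
  show "area_density'' n u (w + w') = area_density'' n u w + area_density'' n u w'" for w w'
    by (simp add: area_density''_def transverse_def inner_add_right algebra_simps add_divide_distrib diff_divide_distrib)
  show "area_density'' n u (c *\<^sub>R w) = c *\<^sub>R area_density'' n u w" for w c
    by (simp add: area_density''_def transverse_def algebra_simps add_divide_distrib diff_divide_distrib)
qed

section \<open>The normal of a parametrised plane\<close>

definition normal :: "real^2^3 \<Rightarrow> real^3" where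
  "normal z = cross3 (column 1 z) (column 2 z)"

text \<open>
  The cross product is bilinear, so this is the polarisation of \<open>normal\<close>; it is both the
  derivative of \<open>normal\<close> at \<open>z\<close> in direction \<open>e\<close> and symmetric in its two arguments.
\<close>

definition dnormal :: "real^2^3 \<Rightarrow> real^2^3 \<Rightarrow> real^3" where
  "dnormal z e = cross3 (column 1 e) (column 2 z) + cross3 (column 1 z) (column 2 e)"

lemma column_add: "column i (z + w) = column i z + column i (w :: real^'n^'m)"
  and column_scaleR: "column i (c *\<^sub>R z) = c *\<^sub>R column i (z :: real^'n^'m)"
  by (simp_all add: column_def vec_eq_iff)

lemma normal_line: "normal (z + t *\<^sub>R e) = normal z + t *\<^sub>R dnormal z e + t\<^sup>2 *\<^sub>R normal e"
  by (simp add: normal_def dnormal_def column_add column_scaleR cross_add_left cross_add_right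
      cross_mult_left cross_mult_right power2_eq_square algebra_simps)

lemma dnormal_line: "dnormal (z + t *\<^sub>R d) e = dnormal z e + t *\<^sub>R dnormal d e"
  by (simp add: dnormal_def column_add column_scaleR cross_add_left cross_add_right
      cross_mult_left cross_mult_right algebra_simps)

lemma linear_dnormal: "linear (dnormal z)"
  by (rule linearI)
     (simp_all add: dnormal_def column_add column_scaleR cross_add_left cross_add_right
      cross_mult_left cross_mult_right algebra_simps)

lemma normal_has_vector_derivative:
  "((\<lambda>t. normal (z + t *\<^sub>R e)) has_vector_derivative dnormal z e) (at 0)"
  unfolding normal_line
  by (auto intro!: derivative_eq_intros)

lemma dnormal_has_vector_derivative:
  "((\<lambda>t. dnormal (z + t *\<^sub>R d) e) has_vector_derivative dnormal d e) (at 0)"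
  unfolding dnormal_line
  by (auto intro!: derivative_eq_intros)

lemma continuous_on_normal: "continuous_on UNIV normal"
  unfolding normal_def column_def
  by (intro continuous_on_cross continuous_intros)

text \<open>
  A matrix whose normal is not parallel to the first axis has rank two, and its column space
  contains vectors with positive and with negative first entry.  These are therefore the points
  at which the plane spanned by the columns meets the cone in a half-plane.
\<close>

definition regular :: "((real^3) \<times> (real^2^3)) set" where
  "regular = {(p, z). p \<in> half_space \<and> transverse (normal z) (normal z) \<noteq> 0}"

lemma open_regular: "open regular"
proof -
  have "continuous_on UNIV (\<lambda>q :: (real^3) \<times> (real^2^3). normal (snd q))"
    by (rule continuous_on_compose2[OF continuous_on_normal]) (auto intro: continuous_intros)
  then have "open {q :: (real^3) \<times> (real^2^3). 0 < fst q $ 3 \<and> transverse (normal (snd q)) (normal (snd q)) \<noteq> 0}"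
    unfolding transverse_def by (intro open_Collect_conj open_Collect_less open_Collect_neq continuous_intros)
  also have "\<dots> = regular"
    by (auto simp: regular_def half_space_def)
  finally show ?thesis .
qed

text \<open>
  Contracting the partial derivatives along the coordinate directions with a matrix \<open>W\<close> is
  evaluating the differential at \<open>W\<close>; this removes the index sums of the mean curvature.
\<close>

lemma sum_matrix_entries:
  assumes "linear f"
  shows "(\<Sum>j\<in>UNIV. \<Sum>\<eta>\<in>UNIV. f (axis j (axis \<eta> 1)) * W $ j $ \<eta>) = f (W :: real^'n^'m)"
proof -
  have "W = (\<Sum>j\<in>UNIV. \<Sum>\<eta>\<in>UNIV. (W $ j $ \<eta>) *\<^sub>R axis j (axis \<eta> 1))"
  proof -
    have "(\<Sum>\<eta>\<in>UNIV. (W $ j $ \<eta>) *\<^sub>R axis j (axis \<eta> 1)) = (axis j (W $ j) :: real^'n^'m)" for j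
      by (auto simp: vec_eq_iff axis_def if_distrib[of "\<lambda>x. _ * x"] cong: if_cong)
    moreover have "(\<Sum>j\<in>UNIV. axis j (W $ j)) = W"
      by (auto simp: vec_eq_iff axis_def if_distrib[of "\<lambda>x. x $ _"] cong: if_cong)
    ultimately show ?thesis by simp
  qed
  then have "f W = f (\<Sum>j\<in>UNIV. \<Sum>\<eta>\<in>UNIV. (W $ j $ \<eta>) *\<^sub>R axis j (axis \<eta> 1))"
    by simp
  also have "\<dots> = (\<Sum>j\<in>UNIV. \<Sum>\<eta>\<in>UNIV. (W $ j $ \<eta>) *\<^sub>R f (axis j (axis \<eta> 1)))"
    by (simp add: linear_sum[OF assms] linear_cmul[OF assms])
  finally show ?thesis
    by (simp add: mult.commute)
qed

section \<open>The unit disc of the induced metric\<close>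

lemma matrix_vector_columns: "z *v y = y $ 1 *\<^sub>R column 1 z + y $ 2 *\<^sub>R column 2 (z :: real^2^'n)"
  by (simp add: vec_eq_iff matrix_vector_mult_def column_def sum_2 mult.commute)

text \<open>
  Completing the square by the Cholesky factor \<open>R\<close> of the quadratic form maps the region onto a
  disc whose boundary passes through the origin: centre \<open>k\<close>, radius \<open>norm k\<close>.  The area is
  the area of that disc divided by the determinant of \<open>R\<close>, and \<open>(norm k)\<^sup>2\<close> is the inverse
  quadratic form evaluated at \<open>(p, q)\<close>.
\<close>

lemma measure_ellipse:
  fixes a c d p q :: real
  assumes a: "0 < a" and \<Delta>: "0 < a * d - c\<^sup>2"
  shows "measure lebesgue {y :: real^2. a * (y$1)\<^sup>2 + 2 * c * y$1 * y$2 + d * (y$2)\<^sup>2 < 2 * (p * y$1 + q * y$2)}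
    = pi * (a * q\<^sup>2 - 2 * c * p * q + d * p\<^sup>2) / sqrt (a * d - c\<^sup>2) ^ 3"
    (is "measure lebesgue ?D = _")
proof -
  define \<Delta> where "\<Delta> = a * d - c\<^sup>2"
  define r s where "r = sqrt a" and "s = sqrt \<Delta>"
  have pos: "0 < r" "0 < s" using assms by (auto simp: r_def s_def \<Delta>_def)
  have sq: "a = r\<^sup>2" "s\<^sup>2 = r\<^sup>2 * d - c\<^sup>2" using assms by (auto simp: r_def s_def \<Delta>_def)
  then have d: "d = (s\<^sup>2 + c\<^sup>2) / r\<^sup>2" using pos by (simp add: field_simps)
  define L :: "real^2^2" where "L = vector [vector [1 / r, - c / (r * s)], vector [0, r / s]]"
  define R :: "real^2 \<Rightarrow> real^2" where "R y = vector [r * y$1 + c / r * y$2, s / r * y$2]" for y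
  define k :: "real^2" where "k = vector [p / r, (q * r\<^sup>2 - p * c) / (r * s)]"
  have LR: "L *v R y = y" and RL: "R (L *v y) = y" for y
    using pos by (simp_all add: vec_eq_iff forall_2 L_def R_def matrix_vector_mult_def sum_2 field_simps)
  have D: "y \<in> ?D \<longleftrightarrow> R y \<in> ball k (norm k)" for y
  proof -
    have "a * (y$1)\<^sup>2 + 2 * c * y$1 * y$2 + d * (y$2)\<^sup>2 = R y \<bullet> R y"
      using pos by (simp add: R_def inner_vec_def sum_2 sq(1) d field_simps power2_eq_square)
    moreover have "p * y$1 + q * y$2 = k \<bullet> R y"
      using pos by (simp add: R_def k_def inner_vec_def sum_2 field_simps power2_eq_square)
    moreover have "R y \<in> ball k (norm k) \<longleftrightarrow> (norm (k - R y))\<^sup>2 < (norm k)\<^sup>2"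
      by (metis dist_norm mem_ball norm_ge_zero power_less_imp_less_base power_strict_mono pos2)
    moreover have "(norm (k - R y))\<^sup>2 = (norm k)\<^sup>2 - 2 * (k \<bullet> R y) + R y \<bullet> R y"
      by (simp add: power2_norm_eq_inner inner_diff_left inner_diff_right inner_commute)
    ultimately show ?thesis by auto
  qed
  have "?D = (*v) L ` ball k (norm k)"
  proof (intro set_eqI iffI)
    fix y assume "y \<in> ?D"
    then show "y \<in> (*v) L ` ball k (norm k)"
      by (intro image_eqI[of _ _ "R y"]) (use D LR in auto)
  next
    fix y assume "y \<in> (*v) L ` ball k (norm k)"
    then show "y \<in> ?D" using D RL by auto
  qed
  then have "measure lebesgue ?D = \<bar>det L\<bar> * measure lebesgue (ball k (norm k))"
    by (simp add: measure_linear_image matrix_vector_mul_linear)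
  also have "\<bar>det L\<bar> = 1 / s"
    using pos by (simp add: L_def det_2)
  also have "measure lebesgue (ball k (norm k)) = pi * (norm k)\<^sup>2"
    by (simp add: circle_area measure_completion)
  also have "(norm k)\<^sup>2 = (a * q\<^sup>2 - 2 * c * p * q + d * p\<^sup>2) / s\<^sup>2"
    using pos unfolding power2_norm_eq_inner
    by (simp add: k_def inner_vec_def sum_2 sq(1) d field_simps power2_eq_square)
  finally show ?thesis
    by (simp add: s_def \<Delta>_def power3_eq_cube power2_eq_square)
qed

text \<open>
  Both \<open>hyp_alpha\<^sup>2\<close> and \<open>hyp_beta\<close> scale by the inverse square of the height, which therefore
  cancels.  Positivity of the one-form is implied by the quadratic inequality.
\<close>

lemma unit_disc_kropina:
  assumes "p \<in> half_space"
  shows "unit_disc (kropina_cone (hyp_beta b)) (kropina hyp_alpha (hyp_beta b)) (p, z)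
    = {y. (norm (z *v y))\<^sup>2 < b * (z *v y) $ 1}"
proof -
  have p: "0 < p $ 3" using assms by (simp add: half_space_def)
  have "0 < b * v $ 1 / (p $ 3)\<^sup>2 \<and> (hyp_alpha p v)\<^sup>2 / (b * v $ 1 / (p $ 3)\<^sup>2) < 1
      \<longleftrightarrow> (norm v)\<^sup>2 < b * v $ 1" for v
  proof -
    have "(hyp_alpha p v)\<^sup>2 = (norm v)\<^sup>2 / (p $ 3)\<^sup>2"
      by (simp add: hyp_alpha_def norm_vec_def L2_set_def sum_3 power_divide)
    moreover have "0 < b * v $ 1" if "(norm v)\<^sup>2 < b * v $ 1"
      using that by (smt (verit) zero_le_power2)
    ultimately show ?thesis using p by (auto simp: field_simps zero_less_mult_iff)
  qed
  then show ?thesis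
    by (simp add: unit_disc_def kropina_cone_def kropina_def hyp_beta_def)
qed

text \<open>
  The quadratic form of the ellipse is the Gram matrix of the columns, whose determinant is
  \<open>(norm (normal z))\<^sup>2\<close>.  Its adjugate, evaluated at the first row of \<open>z\<close>, is a sum of two squares
  of minors, and these minors are the second and third entries of the normal.
\<close>

lemma vol_ratio_kropina:
  assumes b: "b \<noteq> 0" and reg: "(p, z) \<in> regular"
  shows "vol_ratio (kropina_cone (hyp_beta b)) (kropina hyp_alpha (hyp_beta b)) (p, z)
    = 4 / b\<^sup>2 * area_density (normal z)"
proof -
  have p: "p \<in> half_space" and nz: "transverse (normal z) (normal z) \<noteq> 0"
    using reg by (auto simp: regular_def)
  define X Y where "X = column 1 z" and "Y = column 2 z"
  have N: "normal z = cross3 X Y" by (simp add: normal_def X_def Y_def)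
  have \<Delta>: "(X \<bullet> X) * (Y \<bullet> Y) - (X \<bullet> Y)\<^sup>2 = (norm (normal z))\<^sup>2"
    unfolding N norm_cross by (simp add: power2_norm_eq_inner)
  have n0: "0 < norm (normal z)" using transverse_nonzeroD[OF nz] by simp
  have a: "0 < X \<bullet> X"
    using n0 by (auto simp: N)
  have T: "(X \<bullet> X) * (b / 2 * Y $ 1)\<^sup>2 - 2 * (X \<bullet> Y) * (b / 2 * X $ 1) * (b / 2 * Y $ 1)
      + (Y \<bullet> Y) * (b / 2 * X $ 1)\<^sup>2 = b\<^sup>2 / 4 * transverse (normal z) (normal z)"
    by (simp add: N transverse_def cross3_simps power2_eq_square)
  have "{y. (norm (z *v y))\<^sup>2 < b * (z *v y) $ 1}
     = {y. (X \<bullet> X) * (y$1)\<^sup>2 + 2 * (X \<bullet> Y) * y$1 * y$2 + (Y \<bullet> Y) * (y$2)\<^sup>2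
            < 2 * (b / 2 * X $ 1 * y$1 + b / 2 * Y $ 1 * y$2)}"
    unfolding matrix_vector_columns X_def[symmetric] Y_def[symmetric] power2_norm_eq_inner
    by (simp add: inner_add_left inner_add_right inner_commute power2_eq_square algebra_simps)
  then have vol: "measure lebesgue (unit_disc (kropina_cone (hyp_beta b)) (kropina hyp_alpha (hyp_beta b)) (p, z))
      = pi * (b\<^sup>2 / 4 * transverse (normal z) (normal z)) / norm (normal z) ^ 3"
    using measure_ellipse[OF a, of "Y \<bullet> Y" "X \<bullet> Y" "b / 2 * X $ 1" "b / 2 * Y $ 1"] n0
    by (simp only: unit_disc_kropina[OF p] T \<Delta>) simp
  show ?thesis
    using b n0 nz unfolding vol_ratio_def vol
    by (simp add: circle_area measure_completion area_density_def divide_simps)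
qed

section \<open>The mean curvature in terms of the normal\<close>

lemma partial_z_area_density:
  assumes G: "\<And>p z. (p, z) \<in> regular \<Longrightarrow> G (p, z) = K * area_density (normal z)"
    and reg: "(p, z) \<in> regular"
  shows "partial (0, e) G (p, z) = K * area_density' (normal z) (dnormal z e)"
proof -
  have "partial (0, e) G (p, z) = partial (0, e) (\<lambda>q. K * area_density (normal (snd q))) (p, z)"
    by (rule partial_cong_open[OF open_regular reg]) (use G in \<open>auto split: prod.splits\<close>)
  also have "\<dots> = K * area_density' (normal z) (dnormal z e)"
    using reg area_density_has_derivative[OF normal_has_vector_derivative, of z e]
    by (intro partial_eqI) (auto simp: regular_def intro: DERIV_cmult)
  finally show ?thesis .
qed

lemma partial_z_partial_z_area_density:
  assumes G: "\<And>p z. (p, z) \<in> regular \<Longrightarrow> G (p, z) = K * area_density (normal z)"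
    and reg: "(p, z) \<in> regular"
  shows "partial (0, d) (partial (0, e) G) (p, z) =
     K * (area_density'' (normal z) (dnormal z d) (dnormal z e) + area_density' (normal z) (dnormal d e))"
proof -
  have "partial (0, d) (partial (0, e) G) (p, z)
      = partial (0, d) (\<lambda>q. K * area_density' (normal (snd q)) (dnormal (snd q) e)) (p, z)"
    by (rule partial_cong_open[OF open_regular reg])
       (use partial_z_area_density[of G K] G in \<open>auto split: prod.splits\<close>)
  also have "\<dots> = K * (area_density'' (normal z) (dnormal z d) (dnormal z e) + area_density' (normal z) (dnormal d e))"
    using reg area_density'_has_derivative[OF normal_has_vector_derivative[of z d] dnormal_has_vector_derivative[of z d e]]
    by (intro partial_eqI) (auto simp: regular_def intro: DERIV_cmult)
  finally show ?thesis .
qed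

lemma partial_x_area_density:
  assumes G: "\<And>p z. (p, z) \<in> regular \<Longrightarrow> G (p, z) = K * area_density (normal z)"
    and reg: "(p, z) \<in> regular"
  shows "partial (u, 0) G (p, z) = 0"
proof -
  have "partial (u, 0) G (p, z) = partial (u, 0) (\<lambda>q. K * area_density (normal (snd q))) (p, z)"
    by (rule partial_cong_open[OF open_regular reg]) (use G in \<open>auto split: prod.splits\<close>)
  also have "\<dots> = 0"
    by (intro partial_eqI) simp
  finally show ?thesis .
qed

lemma partial_z_partial_x_area_density:
  assumes G: "\<And>p z. (p, z) \<in> regular \<Longrightarrow> G (p, z) = K * area_density (normal z)"
    and reg: "(p, z) \<in> regular"
  shows "partial (0, d) (partial (u, 0) G) (p, z) = 0"
proof -
  have "partial (0, d) (partial (u, 0) G) (p, z) = partial (0, d) (\<lambda>q. 0) (p, z)"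
    by (rule partial_cong_open[OF open_regular reg])
       (use partial_x_area_density[of G K] G in \<open>auto split: prod.splits\<close>)
  also have "\<dots> = 0"
    by (intro partial_eqI) simp
  finally show ?thesis .
qed

text \<open>
  The gradient of the density enters through the second derivatives of the normal, that is through
  \<open>e\<^sub>i \<times> \<phi>\<^sub>1\<^sub>2 + \<phi>\<^sub>2\<^sub>1 \<times> e\<^sub>i\<close>, which vanishes by the symmetry of mixed partial derivatives.  What
  remains pairs, through the Hessian of the density, the derivative of the normal under a
  displacement along \<open>e\<^sub>i\<close> with \<open>dnormal z (W \<epsilon>)\<close>, the derivative of the normal field along the
  surface.
\<close>

lemma mean_curvature_kropina:
  fixes \<phi> :: "real^2 \<Rightarrow> real^3" and x :: "real^2" and b :: real
  defines "z \<equiv> jacobian \<phi> x"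
    and "W \<equiv> (\<lambda>\<epsilon>. \<chi> j \<eta>. partial (axis \<epsilon> 1) (partial (axis \<eta> 1) (\<lambda>u. \<phi> u $ j)) x)"
  assumes b: "b \<noteq> 0" and reg: "(\<phi> x, z) \<in> regular"
    and symm: "column 2 (W 1) = column 1 (W 2)"
  shows "mean_curvature (kropina_cone (hyp_beta b)) (kropina hyp_alpha (hyp_beta b)) \<phi> (\<lambda>_. axis i 1) x
    = (\<Sum>\<epsilon>\<in>UNIV. area_density'' (normal z) (dnormal z (axis i (axis \<epsilon> 1))) (dnormal z (W \<epsilon>)))
        / area_density (normal z)"
proof -
  define G where "G = vol_ratio (kropina_cone (hyp_beta b)) (kropina hyp_alpha (hyp_beta b))"
  define K where "K = 4 / b\<^sup>2"
  have G: "G (p, z) = K * area_density (normal z)" if "(p, z) \<in> regular" for p z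
    using vol_ratio_kropina[OF b that] by (simp add: G_def K_def)
  have K: "K \<noteq> 0" using b by (simp add: K_def)
  let ?n = "normal z"
  let ?E = "\<lambda>\<epsilon>. axis i (axis \<epsilon> 1) :: real^2^3"
  have "mean_curvature (kropina_cone (hyp_beta b)) (kropina hyp_alpha (hyp_beta b)) \<phi> (\<lambda>_. axis i 1) x
      = 1 / G (\<phi> x, z) * (\<Sum>j\<in>UNIV. \<Sum>\<epsilon>\<in>UNIV. \<Sum>\<eta>\<in>UNIV.
             partial (dir_z i \<epsilon>) (partial (dir_z j \<eta>) G) (\<phi> x, z) * W \<epsilon> $ j $ \<eta>)"
    unfolding mean_curvature_def Let_def G_def[symmetric] z_def[symmetric] dir_x_def
    by (simp add: dir_z_def partial_z_partial_x_area_density[OF G reg] partial_x_area_density[OF G reg]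
        axis_def[of i 1] if_distrib[of "\<lambda>x. _ * x"] W_def cong: if_cong)
  also have "(\<Sum>j\<in>UNIV. \<Sum>\<epsilon>\<in>UNIV. \<Sum>\<eta>\<in>UNIV.
             partial (dir_z i \<epsilon>) (partial (dir_z j \<eta>) G) (\<phi> x, z) * W \<epsilon> $ j $ \<eta>)
      = (\<Sum>\<epsilon>\<in>UNIV. \<Sum>j\<in>UNIV. \<Sum>\<eta>\<in>UNIV. K *
           (area_density'' ?n (dnormal z (?E \<epsilon>)) (dnormal z (axis j (axis \<eta> 1)))
            + area_density' ?n (dnormal (?E \<epsilon>) (axis j (axis \<eta> 1)))) * W \<epsilon> $ j $ \<eta>)"
    by (rule trans[OF sum.swap]) (simp add: dir_z_def partial_z_partial_z_area_density[OF G reg])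
  also have "\<dots> = (\<Sum>\<epsilon>\<in>UNIV. K *
           (area_density'' ?n (dnormal z (?E \<epsilon>)) (dnormal z (W \<epsilon>))
            + area_density' ?n (dnormal (?E \<epsilon>) (W \<epsilon>))))"
  proof (rule sum.cong[OF refl])
    fix \<epsilon> :: 2
    have "linear (\<lambda>w. K * (area_density'' ?n (dnormal z (?E \<epsilon>)) (dnormal z w)
            + area_density' ?n (dnormal (?E \<epsilon>) w)))"
      by (intro linearI)
        (simp_all add: linear_add[OF linear_dnormal] linear_add[OF linear_area_density'] linear_add[OF linear_area_density'']
          linear_cmul[OF linear_dnormal] linear_cmul[OF linear_area_density'] linear_cmul[OF linear_area_density''] algebra_simps)
    from sum_matrix_entries[OF this]
    show "(\<Sum>j\<in>UNIV. \<Sum>\<eta>\<in>UNIV. K *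
           (area_density'' ?n (dnormal z (?E \<epsilon>)) (dnormal z (axis j (axis \<eta> 1)))
            + area_density' ?n (dnormal (?E \<epsilon>) (axis j (axis \<eta> 1)))) * W \<epsilon> $ j $ \<eta>)
       = K * (area_density'' ?n (dnormal z (?E \<epsilon>)) (dnormal z (W \<epsilon>))
            + area_density' ?n (dnormal (?E \<epsilon>) (W \<epsilon>)))" .
  qed
  also have "\<dots> = K * (\<Sum>\<epsilon>\<in>UNIV. area_density'' ?n (dnormal z (?E \<epsilon>)) (dnormal z (W \<epsilon>)))"
  proof -
    have "dnormal (?E 1) (W 1) + dnormal (?E 2) (W 2) = 0"
      using symm by (simp add: dnormal_def column_def vec_eq_iff forall_3 cross3_def axis_def)
    then have "area_density' ?n (dnormal (?E 1) (W 1)) + area_density' ?n (dnormal (?E 2) (W 2)) = 0"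
      by (metis linear_add linear_0 linear_area_density')
    then show ?thesis
      by (simp add: sum_2 add_eq_0_iff algebra_simps)
  qed
  finally show ?thesis
    using K by (simp add: G[OF reg])
qed

section \<open>Second derivatives of separated functions\<close>

text \<open>
  Each component of the parametrisation is a function of \<open>x\<^sup>1\<close> times a function of \<open>x\<^sup>2\<close>.
\<close>

lemma partial_separated:
  fixes G H :: "real \<Rightarrow> real" and g :: "real^2 \<Rightarrow> real"
  assumes "open M" "x \<in> M" and g: "\<And>u. u \<in> M \<Longrightarrow> g u = G (u $ 1) * H (u $ 2)"
  shows "(G has_real_derivative G') (at (x $ 1)) \<Longrightarrow> partial (axis 1 1) g x = G' * H (x $ 2)"
    and "(H has_real_derivative H') (at (x $ 2)) \<Longrightarrow> partial (axis 2 1) g x = G (x $ 1) * H'"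
proof -
  have shift: "((\<lambda>t. K (a + t)) has_real_derivative K') (at 0)"
    if "(K has_real_derivative K') (at a)" for K K' and a :: real
    using that by (simp add: DERIV_def)
  have eq: "partial e g x = partial e (\<lambda>u. G (u $ 1) * H (u $ 2)) x" for e
    by (rule partial_cong_open[OF assms])
  show "partial (axis 1 1) g x = G' * H (x $ 2)" if "(G has_real_derivative G') (at (x $ 1))"
    unfolding eq using shift[OF that]
    by (intro partial_eqI) (auto simp: axis_def intro: DERIV_cmult_right)
  show "partial (axis 2 1) g x = G (x $ 1) * H'" if "(H has_real_derivative H') (at (x $ 2))"
    unfolding eq using shift[OF that]
    by (intro partial_eqI) (auto simp: axis_def intro: DERIV_cmult)
qed

lemma second_partials_separated:
  fixes G H :: "real \<Rightarrow> real" and g :: "real^2 \<Rightarrow> real"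
  assumes M: "open M" "x \<in> M" and g: "\<And>u. u \<in> M \<Longrightarrow> g u = G (u $ 1) * H (u $ 2)"
    and G: "\<And>u. u \<in> M \<Longrightarrow> (G has_real_derivative G' (u $ 1)) (at (u $ 1))"
      "\<And>u. u \<in> M \<Longrightarrow> (G' has_real_derivative G'' (u $ 1)) (at (u $ 1))"
    and H: "\<And>u. u \<in> M \<Longrightarrow> (H has_real_derivative H' (u $ 2)) (at (u $ 2))"
      "\<And>u. u \<in> M \<Longrightarrow> (H' has_real_derivative H'' (u $ 2)) (at (u $ 2))"
  shows "partial (axis 1 1) (partial (axis 1 1) g) x = G'' (x $ 1) * H (x $ 2)"
    and "partial (axis 1 1) (partial (axis 2 1) g) x = G' (x $ 1) * H' (x $ 2)"
    and "partial (axis 2 1) (partial (axis 1 1) g) x = G' (x $ 1) * H' (x $ 2)"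
    and "partial (axis 2 1) (partial (axis 2 1) g) x = G (x $ 1) * H'' (x $ 2)"
proof -
  have 1: "partial (axis 1 1) g u = G' (u $ 1) * H (u $ 2)" if "u \<in> M" for u
    by (rule partial_separated(1)[OF M(1) that g G(1)[OF that]])
  have 2: "partial (axis 2 1) g u = G (u $ 1) * H' (u $ 2)" if "u \<in> M" for u
    by (rule partial_separated(2)[OF M(1) that g H(1)[OF that]])
  show "partial (axis 1 1) (partial (axis 1 1) g) x = G'' (x $ 1) * H (x $ 2)"
    by (rule partial_separated(1)[OF M 1 G(2)[OF M(2)]])
  show "partial (axis 1 1) (partial (axis 2 1) g) x = G' (x $ 1) * H' (x $ 2)"
    by (rule partial_separated(1)[OF M 2 G(1)[OF M(2)]])
  show "partial (axis 2 1) (partial (axis 1 1) g) x = G' (x $ 1) * H' (x $ 2)"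
    by (rule partial_separated(2)[OF M 1 H(1)[OF M(2)]])
  show "partial (axis 2 1) (partial (axis 2 1) g) x = G (x $ 1) * H'' (x $ 2)"
    by (rule partial_separated(2)[OF M 2 H(2)[OF M(2)]])
qed

section \<open>The minimal surface equation of a surface of revolution\<close>

text \<open>
  Here \<open>n\<close> is the normal of the surface, \<open>n\<^sub>1\<close> and \<open>n\<^sub>2\<close> are its derivatives in the two parameters,
  and the other two arguments are the derivatives of the normal under a displacement of the first
  entries of the tangent vectors.  With \<open>s\<close> and \<open>c\<close> the sine and cosine of the angle, clearing
  denominators leaves a polynomial in \<open>S = s\<^sup>2\<close>, apart from the factor \<open>c\<close>: the first entry of the
  normal is \<open>- f * c\<close>.
\<close>

lemma revolution_Euler_Lagrange_identity:
  fixes f f1 f2 s c :: real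
  assumes cs: "c\<^sup>2 + s\<^sup>2 = 1" and f: "f \<noteq> 0" and T0: "s\<^sup>2 + f1\<^sup>2 \<noteq> 0"
  defines "n \<equiv> vector [- f * c, - f * s, f * f1] :: real^3"
    and "n\<^sub>1 \<equiv> vector [- f1 * c, - f1 * s, f1\<^sup>2 + f * f2] :: real^3"
    and "n\<^sub>2 \<equiv> vector [f * s, - f * c, 0] :: real^3"
    and "S \<equiv> s\<^sup>2" and "m \<equiv> f1\<^sup>2" and "k \<equiv> f * f2"
  defines "R \<equiv> 1 + m" and "T \<equiv> S + m"
  shows "(area_density'' n (vector [0, 0, f * c]) n\<^sub>1 + area_density'' n (vector [0, 1, - f1 * s]) n\<^sub>2)
      * (norm n * transverse n n ^ 3)
    = f ^ 7 * c * (k * (3 * (R + m) * T\<^sup>2 - 12 * R * m * T + R\<^sup>2 * (8 * m - 2 * T))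
        - (3 * R * T\<^sup>2 + R\<^sup>2 * (1 - S) * (6 * S - 2 * m)))"
proof -
  define r where "r = norm n"
  define \<sigma> where "\<sigma> = transverse n n"
  have r2: "r\<^sup>2 = f\<^sup>2 * R"
    unfolding r_def power2_norm_eq_inner
    by (simp add: n_def inner_vec_def sum_3 R_def m_def) (use cs in algebra)
  have \<sigma>: "\<sigma> = f\<^sup>2 * T"
    by (simp add: \<sigma>_def n_def transverse_def T_def S_def m_def power2_eq_square algebra_simps)
  have nz: "r \<noteq> 0" "\<sigma> \<noteq> 0"
  proof -
    show "\<sigma> \<noteq> 0" using f T0 by (simp add: \<sigma> T_def S_def m_def)
    then show "r \<noteq> 0" using transverse_nonzeroD by (simp add: \<sigma>_def r_def)
  qed
  have clear: "area_density'' n u w * (r * \<sigma> ^ 3)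
      = 3 * (r\<^sup>2 * (u \<bullet> w) + (n \<bullet> u) * (n \<bullet> w)) * \<sigma>\<^sup>2
        - 6 * r\<^sup>2 * ((n \<bullet> u) * transverse n w + (n \<bullet> w) * transverse n u) * \<sigma>
        + r\<^sup>2 * r\<^sup>2 * (8 * transverse n u * transverse n w - 2 * transverse u w * \<sigma>)" for u w
    using nz unfolding area_density''_def r_def[symmetric] \<sigma>_def[symmetric]
    by (simp add: power2_eq_square power3_eq_cube divide_simps) (simp add: algebra_simps)
  let ?u = "vector [0, 0, f * c] :: real^3" and ?w = "vector [0, 1, - f1 * s] :: real^3"
  have vals: "?u \<bullet> n\<^sub>1 = f * c * (m + k)" "n \<bullet> ?u = f\<^sup>2 * f1 * c" "n \<bullet> n\<^sub>1 = f * f1 * (R + k)"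
    "transverse n n\<^sub>1 = f * f1 * (T + k)" "transverse n ?u = f\<^sup>2 * f1 * c" "transverse ?u n\<^sub>1 = f * c * (m + k)"
    "?w \<bullet> n\<^sub>2 = - f * c" "n \<bullet> ?w = - f * s * R" "n \<bullet> n\<^sub>2 = 0"
    "transverse n n\<^sub>2 = f\<^sup>2 * s * c" "transverse n ?w = - f * s * R" "transverse ?w n\<^sub>2 = - f * c"
    by (simp_all add: n_def n\<^sub>1_def n\<^sub>2_def inner_vec_def sum_3 transverse_def R_def T_def S_def m_def k_def
        power2_eq_square algebra_simps) (use cs in algebra)+
  have "(area_density'' n ?u n\<^sub>1 + area_density'' n ?w n\<^sub>2) * (r * \<sigma> ^ 3) =
     f ^ 7 * c * (3 * R * (m + k - 1) * T\<^sup>2 + 3 * f1\<^sup>2 * (R + k) * T\<^sup>2 - 6 * R * f1\<^sup>2 * (R + T + 2 * k) * T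
       + 6 * R\<^sup>2 * s\<^sup>2 * T + R\<^sup>2 * (- 2 * (m + k - 1) * T + 8 * f1\<^sup>2 * (T + k) - 8 * s\<^sup>2 * R))"
    unfolding distrib_right clear vals r2 unfolding \<sigma> by algebra
  also have "\<dots> = f ^ 7 * c * (k * (3 * (R + m) * T\<^sup>2 - 12 * R * m * T + R\<^sup>2 * (8 * m - 2 * T))
        - (3 * R * T\<^sup>2 + R\<^sup>2 * (1 - S) * (6 * S - 2 * m)))"
    unfolding R_def T_def S_def[symmetric] m_def[symmetric] by algebra
  finally show ?thesis unfolding r_def \<sigma>_def .
qed

lemma quadratic_infinite_zeros:
  fixes a0 a1 a2 :: real
  assumes "infinite A" "\<And>S. S \<in> A \<Longrightarrow> a2 * S\<^sup>2 + a1 * S + a0 = 0"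
  shows "a2 = 0" "a1 = 0" "a0 = 0"
proof -
  have "A \<subseteq> {S. poly [:a0, a1, a2:] S = 0}"
    using assms(2) by (auto simp: power2_eq_square algebra_simps)
  then have "[:a0, a1, a2:] = 0"
    using assms(1) poly_roots_finite finite_subset by blast
  then show "a2 = 0" "a1 = 0" "a0 = 0" by auto
qed

text \<open>
  As a polynomial in \<open>S\<close> the equation has degree two, so each coefficient vanishes.  The
  coefficient of \<open>S\<^sup>2\<close> forces \<open>k = - (1 + m)\<close>, then the constant one reads \<open>4 m (1 + m)\<^sup>2 = 0\<close> and
  forces \<open>m = 0\<close>, and the coefficient of \<open>S\<close> becomes \<open>-4\<close>.
\<close>

lemma revolution_quadratic_contradiction:
  fixes m k :: real
  assumes inf: "infinite A" and m: "0 \<le> m"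
    and eq: "\<And>S. S \<in> A \<Longrightarrow>
      k * (3 * (1 + m + m) * (S + m)\<^sup>2 - 12 * (1 + m) * m * (S + m) + (1 + m)\<^sup>2 * (8 * m - 2 * (S + m)))
      = 3 * (1 + m) * (S + m)\<^sup>2 + (1 + m)\<^sup>2 * (1 - S) * (6 * S - 2 * m)"
  shows False
proof -
  define R where "R = 1 + m"
  note z = quadratic_infinite_zeros[OF inf, where
      ?a2.0 = "3 * k * (1 + 2 * m) - 3 * R + 6 * R\<^sup>2" and
      ?a1.0 = "k * (6 * (1 + 2 * m) * m - 12 * R * m - 2 * R\<^sup>2) - (6 * R * m + R\<^sup>2 * (6 + 2 * m))" and
      ?a0.0 = "k * (3 * (1 + 2 * m) * m\<^sup>2 - 12 * R * m\<^sup>2 + 6 * m * R\<^sup>2) - (3 * R * m\<^sup>2 - 2 * m * R\<^sup>2)"]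
  have "(3 * k * (1 + 2 * m) - 3 * R + 6 * R\<^sup>2) * S\<^sup>2
     + (k * (6 * (1 + 2 * m) * m - 12 * R * m - 2 * R\<^sup>2) - (6 * R * m + R\<^sup>2 * (6 + 2 * m))) * S
     + (k * (3 * (1 + 2 * m) * m\<^sup>2 - 12 * R * m\<^sup>2 + 6 * m * R\<^sup>2) - (3 * R * m\<^sup>2 - 2 * m * R\<^sup>2)) = 0"
    if "S \<in> A" for S
    using eq[OF that] unfolding R_def by algebra
  note z = z[OF this]
  have "3 * (1 + 2 * m) * (k + R) = 0"
    using z(1) unfolding R_def by algebra
  then have k: "k = - R" using m by simp
  have "4 * m * R\<^sup>2 = 0"
    using z(3) unfolding k R_def by algebra
  then have "m = 0" using m by (simp add: R_def)
  then show False using z(2) unfolding k R_def by simp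
qed

text \<open>
  The image of an interval is connected, so a finite one is a single point.  The values of
  \<open>cos (2 * \<theta>)\<close> at the three points \<open>a - h\<close>, \<open>a\<close>, \<open>a + h\<close> would then agree, which the addition
  theorems allow only if the sine and the cosine of \<open>2 * a\<close> both vanish.
\<close>

lemma infinite_sin_squared:
  assumes "0 < d"
  shows "infinite ((\<lambda>\<theta>. (sin \<theta>)\<^sup>2) ` {\<theta>::real. \<bar>\<theta> - a\<bar> < d})"
proof
  let ?I = "{\<theta>::real. \<bar>\<theta> - a\<bar> < d}"
  let ?A = "(\<lambda>\<theta>. (sin \<theta>)\<^sup>2) ` ?I"
  assume fin: "finite ?A"
  have "?I = {a - d<..<a + d}" by auto
  then have "connected ?A"
    by (auto intro!: connected_continuous_image continuous_intros)
  then have "?A = {} \<or> (\<exists>y. ?A = {y})"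
    using fin connected_finite_iff_sing by blast
  moreover have "a \<in> ?I" using assms by simp
  ultimately obtain y where "?A = {y}" by blast
  then have y: "(sin \<theta>)\<^sup>2 = y" if "\<theta> \<in> ?I" for \<theta>
    using that by blast
  \<comment> \<open>The bound by 1 keeps \<open>2 * h\<close> strictly between 0 and \<open>pi\<close>.\<close>
  define h where "h = min (d / 2) 1"
  have h: "0 < h" "h < d" "2 * h < pi" using assms pi_gt3 by (auto simp: h_def)
  have cos: "cos (2 * \<theta>) = 1 - 2 * y" if "\<theta> \<in> ?I" for \<theta>
    using y[OF that] by (simp add: cos_double_sin)
  have "cos (2 * (a + h)) = cos (2 * a)" "cos (2 * (a - h)) = cos (2 * a)"
    using cos[of a] cos[of "a + h"] cos[of "a - h"] h by (simp_all add: abs_if)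
  then have *: "cos (2 * a) * cos (2 * h) - sin (2 * a) * sin (2 * h) = cos (2 * a)"
     "cos (2 * a) * cos (2 * h) + sin (2 * a) * sin (2 * h) = cos (2 * a)"
    by (simp_all add: distrib_left right_diff_distrib cos_add cos_diff)
  have "sin (2 * h) > 0" using h by (intro sin_gt_zero) auto
  moreover from this have "cos (2 * h) \<noteq> 1"
    using sin_squared_eq[of "2 * h"] by auto
  ultimately have "sin (2 * a) = 0" "cos (2 * a) = 0"
    using * by (auto simp: algebra_simps)
  then show False
    using sin_cos_squared_add[of "2 * a"] by simp
qed

section \<open>Non-minimality\<close>

lemma smooth_on_const: "smooth_on S (\<lambda>_. c)"
proof -
  have "Ck_on k S (\<lambda>_. c)" for k
    by (induction k arbitrary: c) auto
  then show ?thesis by (simp add: smooth_on_def)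
qed

lemma smooth_on_real_derivatives:
  fixes f :: "real \<Rightarrow> real"
  assumes "smooth_on S f"
  obtains f1 f2 where
    "\<And>t. t \<in> S \<Longrightarrow> (f has_real_derivative f1 t) (at t)"
    "\<And>t. t \<in> S \<Longrightarrow> (f1 has_real_derivative f2 t) (at t)"
proof -
  define D where "D g = (\<lambda>t. frechet_derivative g (at t) (1::real))" for g :: "real \<Rightarrow> real"
  have D: "(g has_real_derivative D g t) (at t)" if "g differentiable (at t)" for g t
  proof -
    have d: "(g has_derivative frechet_derivative g (at t)) (at t)"
      using that by (simp add: frechet_derivative_works)
    then have "frechet_derivative g (at t) h = D g t * h" for h
      using linear_cmul[OF has_derivative_linear[OF d], of h 1] by (simp add: D_def mult.commute)
    then have "frechet_derivative g (at t) = (*) (D g t)" by auto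
    with d show ?thesis by (simp add: has_field_derivative_def)
  qed
  have "Ck_on 2 S f" using assms by (simp add: smooth_on_def)
  then have "\<forall>t\<in>S. f differentiable (at t)" "\<forall>t\<in>S. D f differentiable (at t)"
    by (simp_all add: numeral_2_eq_2 D_def)
  with D show ?thesis by (intro that[of "D f" "D (D f)"]) auto
qed

text \<open>
  The condition comes from the constant vector field along the first axis.  The first
  component of the normal is a nonzero multiple of the cosine of the angle, so where this cosine
  does not vanish that field is transverse to the surface and already detects the mean curvature.
\<close>

lemma revolution_minimal_equation:
  fixes b :: real and f f1 f2 :: "real \<Rightarrow> real" and M :: "(real^2) set" and \<phi> :: "real^2 \<Rightarrow> real^3"
  assumes b: "b \<noteq> 0" and M: "open M" "x \<in> M" and M1: "M \<subseteq> {x. x $ 1 > 0}"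
    and \<phi>: "\<forall>x\<in>M. \<phi> x = vector [f (x $ 1) * cos (x $ 2), f (x $ 1) * sin (x $ 2), x $ 1]"
    and f: "\<And>t. t > 0 \<Longrightarrow> 0 < f t"
      "\<And>t. t > 0 \<Longrightarrow> (f has_real_derivative f1 t) (at t)"
      "\<And>t. t > 0 \<Longrightarrow> (f1 has_real_derivative f2 t) (at t)"
    and min: "minimal half_space (kropina_cone (hyp_beta b)) (kropina hyp_alpha (hyp_beta b)) M \<phi>"
    and sc: "sin (x $ 2) \<noteq> 0" "cos (x $ 2) \<noteq> 0"
  defines "S \<equiv> (sin (x $ 2))\<^sup>2" and "m \<equiv> (f1 (x $ 1))\<^sup>2" and "k \<equiv> f (x $ 1) * f2 (x $ 1)"
  shows "k * (3 * (1 + m + m) * (S + m)\<^sup>2 - 12 * (1 + m) * m * (S + m) + (1 + m)\<^sup>2 * (8 * m - 2 * (S + m)))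
      = 3 * (1 + m) * (S + m)\<^sup>2 + (1 + m)\<^sup>2 * (1 - S) * (6 * S - 2 * m)"
proof -
  define F F1 F2 s c where "F = f (x $ 1)" and "F1 = f1 (x $ 1)" and "F2 = f2 (x $ 1)"
    and "s = sin (x $ 2)" and "c = cos (x $ 2)"
  have pos: "0 < u $ 1" if "u \<in> M" for u using that M1 by auto
  have comp: "\<phi> u $ 1 = f (u $ 1) * cos (u $ 2)" "\<phi> u $ 2 = f (u $ 1) * sin (u $ 2)"
    "\<phi> u $ 3 = u $ 1 * 1" if "u \<in> M" for u
    using \<phi> that by auto
  note df = f(2)[OF pos] f(3)[OF pos]
  have dcos: "(cos has_real_derivative - sin t) (at t)" "((\<lambda>t. - sin t) has_real_derivative - cos t) (at t)"
    and dsin: "(sin has_real_derivative cos t) (at t)" "(cos has_real_derivative - sin t) (at t)"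
    and did: "((\<lambda>t. t) has_real_derivative 1) (at t)" "((\<lambda>t. 1) has_real_derivative 0) (at t)"
      "((\<lambda>t. 0) has_real_derivative 0) (at t)" for t :: real
    by (auto intro!: derivative_eq_intros)
  note first =
    partial_separated(1)[OF M comp(1) df(1)[OF M(2)]] partial_separated(2)[OF M comp(1) dcos(1)]
    partial_separated(1)[OF M comp(2) df(1)[OF M(2)]] partial_separated(2)[OF M comp(2) dsin(1)]
    partial_separated(1)[OF M, of _ "\<lambda>t. t" "\<lambda>_. 1", OF comp(3) did(1)]
    partial_separated(2)[OF M, of _ "\<lambda>t. t" "\<lambda>_. 1", OF comp(3) did(2)]
  note second =
    second_partials_separated[OF M comp(1) df dcos]
    second_partials_separated[OF M comp(2) df dsin]
    second_partials_separated[OF M, of _ "\<lambda>t. t" "\<lambda>_. 1" "\<lambda>_. 1" "\<lambda>_. 0" "\<lambda>_. 0" "\<lambda>_. 0", OF comp(3) did(1,2) did(2,3)]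
  define z where "z = jacobian \<phi> x"
  define W :: "2 \<Rightarrow> real^2^3" where "W = (\<lambda>\<epsilon>. \<chi> j \<eta>. partial (axis \<epsilon> 1) (partial (axis \<eta> 1) (\<lambda>u. \<phi> u $ j)) x)"
  have z: "column 1 z = vector [F1 * c, F1 * s, 1]" "column 2 z = vector [- F * s, F * c, 0]"
    by (simp_all add: vec_eq_iff forall_3 column_def z_def jacobian_def first F_def F1_def s_def c_def)
  have W1: "column 1 (W 1) = vector [F2 * c, F2 * s, 0]" "column 2 (W 1) = vector [- F1 * s, F1 * c, 0]"
    and W2: "column 1 (W 2) = vector [- F1 * s, F1 * c, 0]" "column 2 (W 2) = vector [- F * c, - F * s, 0]"
    by (simp_all add: vec_eq_iff forall_3 column_def W_def second F_def F1_def F2_def s_def c_def)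
  have cs: "c\<^sup>2 + s\<^sup>2 = 1" by (simp add: s_def c_def)
  have F: "F \<noteq> 0" using f(1)[OF pos[OF M(2)]] by (simp add: F_def)
  have T: "s\<^sup>2 + F1\<^sup>2 \<noteq> 0" using sc by (simp add: s_def sum_power2_eq_zero_iff)
  let ?n = "vector [- F * c, - F * s, F * F1] :: real^3"
  have n: "normal z = ?n"
    by (simp add: normal_def z cross3_def vec_eq_iff forall_3) (use cs in algebra)
  have nz: "transverse ?n ?n \<noteq> 0"
  proof -
    have "transverse ?n ?n = F\<^sup>2 * (s\<^sup>2 + F1\<^sup>2)"
      by (simp add: transverse_def power2_eq_square algebra_simps)
    with F T show ?thesis by simp
  qed
  have reg: "(\<phi> x, z) \<in> regular"
    using nz comp(3)[OF M(2)] pos[OF M(2)] by (simp add: regular_def n half_space_def)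
  have col: "column 1 (axis 1 (axis 1 1) :: real^2^3) = vector [1, 0, 0]" "column 2 (axis 1 (axis 1 1) :: real^2^3) = 0"
    "column 1 (axis 1 (axis 2 1) :: real^2^3) = 0" "column 2 (axis 1 (axis 2 1) :: real^2^3) = vector [1, 0, 0]"
    by (simp_all add: vec_eq_iff forall_3 column_def axis_def)
  have d1: "dnormal z (axis 1 (axis 1 1)) = vector [0, 0, F * c]"
    and d2: "dnormal z (axis 1 (axis 2 1)) = vector [0, 1, - F1 * s]"
    by (simp_all add: dnormal_def z col cross3_def vec_eq_iff forall_3)
  have n1: "dnormal z (W 1) = vector [- F1 * c, - F1 * s, F1\<^sup>2 + F * F2]"
    and n2: "dnormal z (W 2) = vector [F * s, - F * c, 0]"
    by (simp_all add: dnormal_def z W1 W2 cross3_def vec_eq_iff forall_3) (use cs in algebra)+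
  have "mean_curvature (kropina_cone (hyp_beta b)) (kropina hyp_alpha (hyp_beta b)) \<phi> (\<lambda>_. axis 1 1) x = 0"
    using min M(2) smooth_on_const by (auto simp: minimal_def)
  then have "(\<Sum>\<epsilon>\<in>UNIV. area_density'' (normal z) (dnormal z (axis 1 (axis \<epsilon> 1))) (dnormal z (W \<epsilon>)))
        / area_density (normal z) = 0"
    using mean_curvature_kropina[OF b reg[unfolded z_def], of 1] W1 W2 by (simp add: z_def W_def)
  moreover have "area_density ?n \<noteq> 0"
    using nz transverse_nonzeroD[OF nz] by (simp add: area_density_def)
  ultimately have "area_density'' ?n (vector [0, 0, F * c]) (vector [- F1 * c, - F1 * s, F1\<^sup>2 + F * F2])
     + area_density'' ?n (vector [0, 1, - F1 * s]) (vector [F * s, - F * c, 0]) = 0"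
    by (simp only: n sum_2 d1 d2 n1 n2) simp
  with revolution_Euler_Lagrange_identity[OF cs F T, of F2] F sc(2) show ?thesis
    by (simp only: mult_zero_left) (simp add: S_def m_def k_def F_def F1_def F2_def s_def c_def)
qed

theorem theorem1p1:
  fixes b :: real and f :: "real \<Rightarrow> real"
    and M :: "(real^2) set" and \<phi> :: "real^2 \<Rightarrow> real^3"
  assumes "b \<noteq> 0"
    and "smooth_on {0<..} f"
    and "\<forall>t>0. f t > 0"
    and "open M" and "M \<noteq> {}" and "M \<subseteq> {x. x $ 1 > 0}"
    and "\<forall>x\<in>M. \<phi> x = vector [f (x $ 1) * cos (x $ 2), f (x $ 1) * sin (x $ 2), x $ 1]"
    and "immersion M half_space \<phi>"
  shows "\<not> minimal half_space (kropina_cone (hyp_beta b)) (kropina hyp_alpha (hyp_beta b)) M \<phi>"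
proof
  assume min: "minimal half_space (kropina_cone (hyp_beta b)) (kropina hyp_alpha (hyp_beta b)) M \<phi>"
  obtain f1 f2 where f: "\<And>t. t > 0 \<Longrightarrow> (f has_real_derivative f1 t) (at t)"
    "\<And>t. t > 0 \<Longrightarrow> (f1 has_real_derivative f2 t) (at t)"
    using smooth_on_real_derivatives[OF assms(2)] by (metis greaterThan_iff)
  obtain x d where x: "x \<in> M" and d: "0 < d" "ball x d \<subseteq> M"
    using assms(4,5) by (metis all_not_in_conv openE)
  let ?A = "(\<lambda>\<theta>. (sin \<theta>)\<^sup>2) ` {\<theta>. \<bar>\<theta> - x $ 2\<bar> < d}"
  \<comment> \<open>Removing 0 and 1 leaves only angles whose sine and cosine are both nonzero.\<close>
  have "infinite (?A - {0, 1})"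
    using infinite_sin_squared[OF d(1)] by simp
  moreover have "f (x $ 1) * f2 (x $ 1) * (3 * (1 + m + m) * (S + m)\<^sup>2 - 12 * (1 + m) * m * (S + m)
        + (1 + m)\<^sup>2 * (8 * m - 2 * (S + m)))
      = 3 * (1 + m) * (S + m)\<^sup>2 + (1 + m)\<^sup>2 * (1 - S) * (6 * S - 2 * m)"
    if m: "m = (f1 (x $ 1))\<^sup>2" and S: "S \<in> ?A - {0, 1}" for S m
  proof -
    obtain \<theta> where \<theta>: "\<bar>\<theta> - x $ 2\<bar> < d" "S = (sin \<theta>)\<^sup>2" using S by auto
    define y :: "real^2" where "y = x + (\<theta> - x $ 2) *\<^sub>R axis 2 1"
    have y: "y $ 1 = x $ 1" "y $ 2 = \<theta>" by (simp_all add: y_def axis_def)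
    have "dist x y < d" using \<theta>(1) by (simp add: y_def dist_norm)
    then have "y \<in> M" using d(2) by auto
    moreover have "sin \<theta> \<noteq> 0" "cos \<theta> \<noteq> 0"
      using S sin_cos_squared_add[of \<theta>] unfolding \<theta>(2) by (auto simp del: sin_cos_squared_add)
    ultimately show ?thesis
      using revolution_minimal_equation[OF assms(1,4) _ assms(6,7) _ f min, of y] assms(3)
      unfolding y m \<theta>(2) by blast
  qed
  ultimately show False
    using revolution_quadratic_contradiction[of "?A - {0, 1}" "(f1 (x $ 1))\<^sup>2" "f (x $ 1) * f2 (x $ 1)"]
    by simp
qed
end
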